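(* Let $F=\{x\in K: f_j(x)\le a_j,\ j=1,\ldots,m\}$ and $\overline J=\{j\in\{1,\ldots,m\}: f_j(x)=a_j\ \ \forall x\in F\}$. Consider the procedure that, for each $j\in\{1,\ldots,m\}\setminus\overline J$, picks any $x^j\in F$ with $f_j(x^j)<a_j$, and, if $|\overline J|<m$, returns $$\overline x=\frac{1}{m-|\overline J|}\sum_{j\notin\overline J}x^j$$ together with $\overline J$ (if $|\overline J|=m$ it returns $\overline J$ only). The following statements hold: (i) if $|\overline J|=0$, then the procedure returns a Slater point $\overline x$, i.e. $\overline x\in K$ with $f_j(\overline x)<a_j$ for all $j=1,\ldots,m$; (ii) if $0<|\overline J|<m$, then $F\subseteq W$; (iii) if $|\overline J|=m$, then $F\subseteq P$.
   Context: Setting: $K\subseteq\mathbb{R}^n$ is closed and convex; $f=(f_1,\ldots,f_m)^{\mathsf T}:\mathbb{R}^n\to\mathbb{R}^m$ with each $f_j$ convex and continuously differentiable; $a=(a_1,\ldots,a_m)^{\mathsf T}\in\mathbb{R}^m$; the set $F$ is nonempty and bounded. The multi-objective problem is to minimize $f(x)$ over $x\in K$. $P$ is the set of Pareto optimal points: $\widehat x\in K$ such that for every $x\in K$ either there is $j$ with $f_j(\widehat x)<f_j(x)$, or $f_j(\widehat x)\le f_j(x)$ for all $j$. $W$ is the set of weak Pareto optimal points: $\widehat x\in K$ such that for every $x\in K$ there is $j$ with $f_j(\widehat x)\le f_j(x)$. *)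

theory Defs
  imports "HOL-Analysis.Analysis"
begin

definition continuously_differentiable :: "('a::real_inner \<Rightarrow> real) \<Rightarrow> bool" where
  "continuously_differentiable g \<longleftrightarrow>
     (\<exists>D. (\<forall>x. GDERIV g x :> D x) \<and> continuous_on UNIV D)"

definition feasible_set ::
  "(real^'n) set \<Rightarrow> (real^'n \<Rightarrow> real^'m) \<Rightarrow> real^'m \<Rightarrow> (real^'n) set" where
  "feasible_set K f a = {x \<in> K. \<forall>j. f x $ j \<le> a $ j}"

definition always_active ::
  "(real^'n) set \<Rightarrow> (real^'n \<Rightarrow> real^'m) \<Rightarrow> real^'m \<Rightarrow> 'm set" where
  "always_active K f a = {j. \<forall>x \<in> feasible_set K f a. f x $ j = a $ j}"

definition pareto_optimal ::
  "(real^'n) set \<Rightarrow> (real^'n \<Rightarrow> real^'m) \<Rightarrow> (real^'n) set" where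
  "pareto_optimal K f =
     {xh \<in> K. \<forall>x \<in> K. (\<exists>j. f xh $ j < f x $ j) \<or> (\<forall>j. f xh $ j \<le> f x $ j)}"

definition weak_pareto_optimal ::
  "(real^'n) set \<Rightarrow> (real^'n \<Rightarrow> real^'m) \<Rightarrow> (real^'n) set" where
  "weak_pareto_optimal K f = {xh \<in> K. \<forall>x \<in> K. \<exists>j. f xh $ j \<le> f x $ j}"

definition slater_point ::
  "(real^'n) set \<Rightarrow> (real^'n \<Rightarrow> real^'m) \<Rightarrow> real^'m \<Rightarrow> real^'n \<Rightarrow> bool" where
  "slater_point K f a x \<longleftrightarrow> x \<in> K \<and> (\<forall>j. f x $ j < a $ j)"

text \<open>
  The procedure picks the points \<open>xs j\<close> arbitrarily, so it is modelled as a relation between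
  its input and its possible outputs. The first component of an output is the averaged point,
  or \<open>None\<close> if only the index set is returned.
\<close>

inductive procedure_returns ::
  "(real^'n) set \<Rightarrow> (real^'n \<Rightarrow> real^'m) \<Rightarrow> real^'m \<Rightarrow> (real^'n) option \<times> 'm set \<Rightarrow> bool"
  for K :: "(real^'n) set" and f :: "real^'n \<Rightarrow> real^'m" and a :: "real^'m" where
  averaged:
    "\<lbrakk>J = always_active K f a; card J < CARD('m);
      \<forall>j \<in> UNIV - J. xs j \<in> feasible_set K f a \<and> f (xs j) $ j < a $ j\<rbrakk> \<Longrightarrow>
     procedure_returns K f a
       (Some ((1 / (real CARD('m) - real (card J))) *\<^sub>R (\<Sum>j \<in> UNIV - J. xs j)), J)"
| index_set_only:
    "\<lbrakk>J = always_active K f a; card J = CARD('m)\<rbrakk> \<Longrightarrow> procedure_returns K f a (None, J)"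

end

theory Submission
  imports Defs
begin

text \<open>
  For (i), an index outside the always active set has a feasible point at which its constraint is
  strict, because feasibility already gives \<open>f x $ j \<le> a $ j\<close>. By Jensen's inequality the mean of
  these points inherits every one of the strict inequalities: each constraint holds weakly at all
  of the averaged points and strictly at one of them
  (\<open>convex_on_average_less\<close>, \<open>slater_point_average\<close>).

  For (ii) and (iii), improvement preserves feasibility: a point of \<open>K\<close> at least as good as a
  feasible point in every objective is feasible (\<open>feasible_set_downward\<close>). An always active
  objective is constant, equal to its bound, on the feasible set, so from a feasible
  point it cannot be improved without worsening another objective
  (\<open>always_active_no_improvement\<close>). One such objective excludes a simultaneous strict improvement
  of all objectives, which is weak Pareto optimality; if all objectives are of this kind, then
  every feasible point is Pareto optimal.
\<close>

lemma feasible_set_downward: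
  assumes "x \<in> feasible_set K f a" "y \<in> K" "\<forall>j. f y $ j \<le> f x $ j"
  shows "y \<in> feasible_set K f a"
  using assms unfolding feasible_set_def by (auto intro: order_trans)

lemma always_active_no_improvement:
  assumes "k \<in> always_active K f a" "x \<in> feasible_set K f a" "y \<in> K"
    and "\<forall>j. f y $ j \<le> f x $ j"
  shows "f y $ k = f x $ k"
  using assms feasible_set_downward[OF assms(2-4)] by (simp add: always_active_def)

lemma not_always_active_iff:
  "j \<notin> always_active K f a \<longleftrightarrow> (\<exists>x \<in> feasible_set K f a. f x $ j < a $ j)"
  unfolding always_active_def feasible_set_def by (force simp: less_le)

text \<open>
  The weight of every point in the mean is positive, so one strict inequality among the values
  makes the mean of the values, which bounds the value at the mean by Jensen, strictly smaller
  than the common bound.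
\<close>

lemma convex_on_average_less:
  fixes g :: "'a::real_vector \<Rightarrow> real"
  assumes g: "convex_on C g" and I: "finite I" "k \<in> I"
    and C: "\<And>i. i \<in> I \<Longrightarrow> y i \<in> C"
    and le: "\<And>i. i \<in> I \<Longrightarrow> g (y i) \<le> c" and less: "g (y k) < c"
  shows "g ((1 / real (card I)) *\<^sub>R (\<Sum>i\<in>I. y i)) < c"
proof -
  have pos: "card I > 0"
    using I card_gt_0_iff by blast
  have "g (\<Sum>i\<in>I. (1 / real (card I)) *\<^sub>R y i) \<le> (\<Sum>i\<in>I. (1 / real (card I)) * g (y i))"
    using I pos C by (intro convex_on_sum[OF _ _ g]) auto
  also have "\<dots> < (\<Sum>i\<in>I. (1 / real (card I)) * c)"
    using I pos le less
    by (intro sum_strict_mono_ex1 bexI[of _ k])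
       (auto simp: divide_right_mono divide_strict_right_mono)
  also have "\<dots> = c"
    using pos by simp
  finally show ?thesis
    by (simp add: scaleR_sum_right)
qed

lemma slater_point_average:
  fixes f :: "real^'n \<Rightarrow> real^'m"
  assumes K: "convex K" and f: "\<forall>j. convex_on UNIV (\<lambda>x. f x $ j)"
    and xs: "\<forall>j. xs j \<in> feasible_set K f a \<and> f (xs j) $ j < a $ j"
  shows "slater_point K f a ((1 / real CARD('m)) *\<^sub>R (\<Sum>j\<in>UNIV. xs j))"
  unfolding slater_point_def
proof (intro conjI allI)
  have "(\<Sum>j\<in>UNIV. (1 / real CARD('m)) *\<^sub>R xs j) \<in> K"
    using xs by (intro convex_sum[OF _ K]) (auto simp: feasible_set_def)
  then show "(1 / real CARD('m)) *\<^sub>R (\<Sum>j\<in>UNIV. xs j) \<in> K"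
    by (simp add: scaleR_sum_right)
  show "f ((1 / real CARD('m)) *\<^sub>R (\<Sum>j\<in>UNIV. xs j)) $ k < a $ k" for k
    using f xs
    by (intro convex_on_average_less[where C = UNIV and k = k and g = "\<lambda>x. f x $ k"])
       (auto simp: feasible_set_def)
qed

text \<open>
  The procedure never gets stuck, since the points it has to pick exist by the definition of the
  always active set. Without this the claim about all of its outputs could hold vacuously.
\<close>

lemma procedure_returns_total: "\<exists>out. procedure_returns K f a out"
  for f :: "real^'n \<Rightarrow> real^'m"
proof (cases "card (always_active K f a) = CARD('m)")
  case True
  then show ?thesis
    using procedure_returns.index_set_only by blast
next
  case False
  then have "card (always_active K f a) < CARD('m)"
    by (simp add: card_mono le_neq_implies_less)
  moreover have "\<forall>j \<in> UNIV - always_active K f a. \<exists>x. x \<in> feasible_set K f a \<and> f x $ j < a $ j"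
    using not_always_active_iff by blast
  then obtain xs where
    "\<forall>j \<in> UNIV - always_active K f a. xs j \<in> feasible_set K f a \<and> f (xs j) $ j < a $ j"
    by metis
  ultimately show ?thesis
    using procedure_returns.averaged[OF refl] by blast
qed

lemma procedure_returns_slater_point:
  fixes f :: "real^'n \<Rightarrow> real^'m"
  assumes "convex K" "\<forall>j. convex_on UNIV (\<lambda>x. f x $ j)"
    and J: "always_active K f a = {}"
    and out: "procedure_returns K f a out"
  shows "\<exists>xbar. out = (Some xbar, always_active K f a) \<and> slater_point K f a xbar"
  using out
proof cases
  case (averaged J xs)
  then show ?thesis
    using slater_point_average[OF assms(1,2), of xs a] J by simp
next
  case (index_set_only J)
  then show ?thesis
    using J by simp
qed

lemma feasible_subset_weak_pareto:
  assumes "k \<in> always_active K f a"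
  shows "feasible_set K f a \<subseteq> weak_pareto_optimal K f"
proof
  fix x assume x: "x \<in> feasible_set K f a"
  have "\<exists>j. f x $ j \<le> f y $ j" if "y \<in> K" for y
    using always_active_no_improvement[OF assms x that] by (metis linorder_le_cases order.refl)
  then show "x \<in> weak_pareto_optimal K f"
    using x by (simp add: weak_pareto_optimal_def feasible_set_def)
qed

lemma feasible_subset_pareto:
  assumes "always_active K f a = UNIV"
  shows "feasible_set K f a \<subseteq> pareto_optimal K f"
proof
  fix x assume x: "x \<in> feasible_set K f a"
  have "(\<exists>j. f x $ j < f y $ j) \<or> (\<forall>j. f x $ j \<le> f y $ j)" if "y \<in> K" for y
    using always_active_no_improvement[OF _ x that] assms by (metis UNIV_I not_le order.refl)
  then show "x \<in> pareto_optimal K f"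
    using x by (simp add: pareto_optimal_def feasible_set_def)
qed

theorem theorem4p5:
  fixes K :: "(real^'n) set"
    and f :: "real^'n \<Rightarrow> real^'m"
    and a :: "real^'m"
  assumes "closed K" and "convex K"
    and "\<forall>j. convex_on UNIV (\<lambda>x. f x $ j)"
    and "\<forall>j. continuously_differentiable (\<lambda>x. f x $ j)"
    and "feasible_set K f a \<noteq> {}" and "bounded (feasible_set K f a)"
  shows "(card (always_active K f a) = 0 \<longrightarrow>
           (\<exists>out. procedure_returns K f a out) \<and>
           (\<forall>out. procedure_returns K f a out \<longrightarrow>
              (\<exists>xbar. out = (Some xbar, always_active K f a) \<and> slater_point K f a xbar))) \<and>
         (0 < card (always_active K f a) \<and> card (always_active K f a) < CARD('m) \<longrightarrow>
           feasible_set K f a \<subseteq> weak_pareto_optimal K f) \<and>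
         (card (always_active K f a) = CARD('m) \<longrightarrow>
           feasible_set K f a \<subseteq> pareto_optimal K f)"
proof (intro conjI impI)
  show "\<exists>out. procedure_returns K f a out"
    by (rule procedure_returns_total)
next
  assume "card (always_active K f a) = 0"
  then show "\<forall>out. procedure_returns K f a out \<longrightarrow>
      (\<exists>xbar. out = (Some xbar, always_active K f a) \<and> slater_point K f a xbar)"
    using procedure_returns_slater_point[OF assms(2,3)] by simp
next
  assume "0 < card (always_active K f a) \<and> card (always_active K f a) < CARD('m)"
  then obtain k where "k \<in> always_active K f a"
    by (auto simp: card_gt_0_iff)
  then show "feasible_set K f a \<subseteq> weak_pareto_optimal K f"
    by (rule feasible_subset_weak_pareto)
next
  assume "card (always_active K f a) = CARD('m)"
  then have "always_active K f a = UNIV"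
    by (simp add: card_eq_UNIV_imp_eq_UNIV)
  then show "feasible_set K f a \<subseteq> pareto_optimal K f"
    by (rule feasible_subset_pareto)
qed

end
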